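(* For each $u\in\mu_{q-1}$, the power series $$\mathcal{E}_{u,2}(X)=\exp\left(\omega_uX-u\omega_uX^p+\frac{\gamma X^p-\gamma X^{p^2}}{p}\right)$$ is over-convergent.
   Context: $p$ is an odd prime, $K\subset\bar{\mathbb{Q}}_p$ an unramified extension of $\mathbb{Q}_p$ of degree $d$, $q=p^d$, and $\mu_n$ denotes the $n$th roots of unity in $\bar{\mathbb{Q}}_p$. Let $\gamma\in\bar{\mathbb{Q}}_p$ be a root of $X^{p-1}+p$. For $u\in\mu_{q-1}$ let $f_u(X)=X^p+upX$ and let $\omega_u$ be a root of $f_u(X)-\gamma$. A power series with coefficients in an algebraic extension of $\mathbb{Q}_p$ is over-convergent if it converges on $\{x\in\bar{\mathbb{Q}}_p:|x|_p<1+\epsilon\}$ for some $\epsilon>0$, where $|p|_p=p^{-1}$. *)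

theory Defs
  imports
    "HOL-Analysis.Analysis"
    "HOL-Computational_Algebra.Formal_Power_Series"
    "HOL-Algebra.Algebraic_Closure_Type"
begin

text \<open>
  The libraries contain neither \<open>Q\<^sub>p\<close> nor its algebraic closure. A model of the latter is taken
  to be an algebraically closed field \<open>'a\<close> of characteristic 0 with an absolute value \<open>absv\<close>
  such that the closure of the rationals in \<open>'a\<close> is their completion \<open>Q\<^sub>p\<close> and \<open>'a\<close> is algebraic
  over it. This determines \<open>('a, absv)\<close> up to an isometric isomorphism.
\<close>

definition Qp :: "('a :: field_char_0 \<Rightarrow> real) \<Rightarrow> 'a set" where
  "Qp absv = {x. \<forall>e>0. \<exists>r :: rat. absv (x - of_rat r) < e}"

definition converges_to :: "('a :: field \<Rightarrow> real) \<Rightarrow> (nat \<Rightarrow> 'a) \<Rightarrow> 'a \<Rightarrow> bool" where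
  "converges_to absv s l \<longleftrightarrow> (\<lambda>n. absv (s n - l)) \<longlonglongrightarrow> 0"

definition cauchy_seq :: "('a :: field \<Rightarrow> real) \<Rightarrow> (nat \<Rightarrow> 'a) \<Rightarrow> bool" where
  "cauchy_seq absv s \<longleftrightarrow> (\<forall>e>0. \<exists>N. \<forall>m\<ge>N. \<forall>n\<ge>N. absv (s m - s n) < e)"

text \<open>
  For prime \<open>p\<close>, the first five assumptions already force, on the rationals, \<open>absv\<close> to be the \<open>p\<close>-adic absolute
  value: the ultrametric inequality bounds it by 1 on the integers, and an integer prime to \<open>p\<close>
  cannot have absolute value less than 1, by Bezout.
\<close>

locale padic_algebraic_closure =
  fixes p :: nat and absv :: "'a :: {alg_closed_field, field_char_0} \<Rightarrow> real"
  assumes absv_nonneg: "absv x \<ge> 0"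
    and absv_eq_0_iff: "absv x = 0 \<longleftrightarrow> x = 0"
    and absv_mult: "absv (x * y) = absv x * absv y"
    and absv_ultrametric: "absv (x + y) \<le> max (absv x) (absv y)"
    and absv_p: "absv (of_nat p) = 1 / real p"
    and Qp_complete: "range s \<subseteq> Qp absv \<Longrightarrow> cauchy_seq absv s \<Longrightarrow> \<exists>l \<in> Qp absv. converges_to absv s l"
    and algebraic_over_Qp: "\<exists>P :: 'a poly. P \<noteq> 0 \<and> (\<forall>i. Polynomial.coeff P i \<in> Qp absv) \<and> poly P x = 0"

text \<open>
  Ramification index 1 is stated as equality of the value groups. The residue fields are finite,
  so separability of the residue extension is automatic.
\<close>

definition unramified_extension ::
    "('a :: field_char_0 \<Rightarrow> real) \<Rightarrow> nat \<Rightarrow> 'a set \<Rightarrow> bool" where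
  "unramified_extension absv d K \<longleftrightarrow>
     subfield K (ring_of_type_algebra :: 'a ring) \<and>
     Qp absv \<subseteq> K \<and>
     ring.dimension (ring_of_type_algebra :: 'a ring) d (Qp absv) K \<and>
     absv ` (K - {0}) = absv ` (Qp absv - {0})"

definition f_poly :: "nat \<Rightarrow> 'a :: field \<Rightarrow> 'a poly" where
  "f_poly p u = Polynomial.monom 1 p + Polynomial.monom (u * of_nat p) 1"

text \<open>
  The sum of the series is required to lie in \<open>'a\<close> itself, not merely in its completion.
\<close>

definition overconvergent :: "('a :: field \<Rightarrow> real) \<Rightarrow> 'a fps \<Rightarrow> bool" where
  "overconvergent absv F \<longleftrightarrow>
     (\<exists>\<epsilon>>0. \<forall>x. absv x < 1 + \<epsilon> \<longrightarrow>
        (\<exists>l. converges_to absv (\<lambda>N. \<Sum>n<N. fps_nth F n * x ^ n) l))"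

text \<open>The exponential of a series with zero constant term is composition with \<open>fps_exp 1\<close>.\<close>

definition E2 :: "nat \<Rightarrow> 'a :: field_char_0 \<Rightarrow> 'a \<Rightarrow> 'a \<Rightarrow> 'a fps" where
  "E2 p \<gamma> u \<omega> = fps_exp 1 oo
     (fps_const \<omega> * fps_X - fps_const (u * \<omega>) * fps_X ^ p +
      fps_const (1 / of_nat p) * (fps_const \<gamma> * fps_X ^ p - fps_const \<gamma> * fps_X ^ (p ^ 2)))"

end

theory Submission
  imports
    Defs
    "HOL-Number_Theory.Residues"
    "HOL-Computational_Algebra.Formal_Laurent_Series"
begin

text \<open>
  Put \<open>\<theta> = |\<gamma>|\<close>, so that \<open>\<theta>^(p-1) = 1/p\<close> and \<open>|\<omega>|^p = \<theta>\<close>. Since \<open>\<gamma> = \<omega>^p + u p \<omega>\<close> and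
  \<open>-\<gamma>/p = \<gamma>^p/p^2\<close>, the exponent of the series equals
  \<open>\<omega> X + (\<omega> X)^p/p + \<gamma>^p X^(p^2)/p^2\<close>. Up to a small error in the last coefficient this is the
  beginning of \<open>L(\<omega> X)\<close>, where \<open>L(T) = \<Sum>k. T^(p^k)/p^k\<close>. Hence the series is the product of
  \<open>E(\<omega> X)\<close>, where \<open>E = exp L\<close> is the Artin-Hasse exponential, and of \<open>exp g\<close> with
  \<open>g = (\<gamma>^p - \<omega>^(p^2)) X^(p^2)/p^2 - (\<Sum>k\<ge>3. (\<omega> X)^(p^k)/p^k)\<close>. The coefficients of \<open>E\<close> are
  \<open>p\<close>-integral by Dwork's argument, and \<open>|\<omega>| < 1\<close>. The coefficients of \<open>g\<close> are at most
  \<open>\<theta> r^n\<close> for \<open>r = \<theta>^(1/p^3) < 1\<close>, hence those of \<open>exp g\<close> are at most \<open>r^n\<close> because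
  \<open>|n!| \<ge> \<theta>^(n-1)\<close>. So the terms of the series tend to 0 on \<open>|x| < 1/r\<close>. The partial sums lie in the
  finite extension \<open>Q\<^sub>p(\<omega>, \<gamma>, u, x)\<close>, which is complete.
\<close>

section \<open>Non-archimedean absolute values\<close>

locale nonarch_absv =
  fixes absv :: "'a :: field_char_0 \<Rightarrow> real"
  assumes absv_nonneg [simp]: "absv x \<ge> 0"
    and absv_eq_0_iff [simp]: "absv x = 0 \<longleftrightarrow> x = 0"
    and absv_mult: "absv (x * y) = absv x * absv y"
    and absv_ultrametric: "absv (x + y) \<le> max (absv x) (absv y)"
begin

lemma absv_0 [simp]: "absv 0 = 0"
  by simp

lemma absv_1 [simp]: "absv 1 = 1"
  using absv_mult[of 1 1] absv_eq_0_iff[of 1] by simp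

lemma absv_power: "absv (x ^ n) = absv x ^ n"
  by (induction n) (auto simp: absv_mult)

lemma absv_inverse: "absv (inverse x) = inverse (absv x)"
proof (cases "x = 0")
  case False
  then have "absv x * absv (inverse x) = 1"
    by (simp flip: absv_mult)
  then show ?thesis
    by (simp add: inverse_unique)
qed auto

lemma absv_divide: "absv (x / y) = absv x / absv y"
  by (simp add: divide_inverse absv_mult absv_inverse)

lemma absv_root_of_unity:
  assumes "x ^ n = 1" "n > 0"
  shows "absv x = 1"
proof -
  have "absv x ^ n = 1"
    using assms by (simp flip: absv_power)
  then show ?thesis
    using \<open>n > 0\<close> power_eq_1_iff[of "absv x" n] by simp
qed

lemma absv_minus [simp]: "absv (- x) = absv x"
proof -
  have "absv (- 1) = 1"
    by (rule absv_root_of_unity[of _ 2]) auto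
  then show ?thesis
    using absv_mult[of "- 1" x] by simp
qed

lemma absv_minus_commute: "absv (x - y) = absv (y - x)"
  by (metis absv_minus minus_diff_eq)

lemma absv_add_le: "absv x \<le> c \<Longrightarrow> absv y \<le> c \<Longrightarrow> absv (x + y) \<le> c"
  using absv_ultrametric[of x y] by linarith

lemma absv_diff_le: "absv x \<le> c \<Longrightarrow> absv y \<le> c \<Longrightarrow> absv (x - y) \<le> c"
  using absv_add_le[of x c "- y"] by simp

lemma absv_add_less: "absv x < c \<Longrightarrow> absv y < c \<Longrightarrow> absv (x + y) < c"
  using absv_ultrametric[of x y] by linarith

lemma absv_diff_less: "absv x < c \<Longrightarrow> absv y < c \<Longrightarrow> absv (x - y) < c"
  using absv_add_less[of x c "- y"] by simp

text \<open>In \<open>x = (x + y) - y\<close> the term \<open>y\<close> is strictly smaller than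
  \<open>x\<close>, so the maximum in the ultrametric inequality has to come from
  \<open>x + y\<close>.\<close>

lemma absv_add_eq:
  assumes "absv y < absv x"
  shows "absv (x + y) = absv x"
proof (rule antisym)
  show "absv (x + y) \<le> absv x"
    using absv_ultrametric[of x y] assms by simp
  show "absv x \<le> absv (x + y)"
    using absv_ultrametric[of "x + y" "- y"] assms by simp
qed

lemma absv_sum_le:
  assumes "\<And>i. i \<in> I \<Longrightarrow> absv (f i) \<le> c" "c \<ge> 0"
  shows "absv (\<Sum>i\<in>I. f i) \<le> c"
  using assms by (induction I rule: infinite_finite_induct) (auto intro: absv_add_le)

lemma absv_mult_le:
  "absv x \<le> c \<Longrightarrow> absv y \<le> d \<Longrightarrow> absv (x * y) \<le> c * d"
  using order_trans[OF absv_nonneg] by (auto simp: absv_mult intro!: mult_mono)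

lemma absv_of_nat_le: "absv (of_nat n) \<le> 1"
  by (induction n) (auto intro: absv_add_le)

lemma absv_of_int_le: "absv (of_int n) \<le> 1"
  by (cases n rule: int_cases2) (auto simp: absv_of_nat_le)

text \<open>For \<open>r > 0\<close> this says that the Gauss norm of \<open>F\<close> on the disc
  of radius \<open>1 / r\<close> is at most \<open>M\<close>. At a fixed rate \<open>r\<close>,
  products simply multiply the constants.\<close>

definition fps_bounded :: "real \<Rightarrow> real \<Rightarrow> 'a fps \<Rightarrow> bool" where
  "fps_bounded M r F \<longleftrightarrow> (\<forall>n. absv (fps_nth F n) \<le> M * r ^ n)"

lemma fps_boundedD: "fps_bounded M r F \<Longrightarrow> absv (fps_nth F n) \<le> M * r ^ n"
  by (simp add: fps_bounded_def)

lemma fps_bounded_mono: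
  assumes "fps_bounded M r F" "M \<le> M'" "0 \<le> M'" "r \<le> r'" "0 \<le> r"
  shows "fps_bounded M' r' F"
  unfolding fps_bounded_def
proof
  fix n
  have "absv (fps_nth F n) \<le> M * r ^ n"
    using assms(1) by (rule fps_boundedD)
  also have "\<dots> \<le> M' * r' ^ n"
    using assms by (intro mult_mono power_mono) auto
  finally show "absv (fps_nth F n) \<le> M' * r' ^ n" .
qed

lemma fps_bounded_0 [simp]: "0 \<le> M \<Longrightarrow> 0 \<le> r \<Longrightarrow> fps_bounded M r 0"
  by (simp add: fps_bounded_def)

lemma fps_bounded_1: "1 \<le> M \<Longrightarrow> 0 \<le> r \<Longrightarrow> fps_bounded M r 1"
  by (simp add: fps_bounded_def)

lemma fps_bounded_add:
  "fps_bounded M r F \<Longrightarrow> fps_bounded M r G \<Longrightarrow> fps_bounded M r (F + G)"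
  by (auto simp: fps_bounded_def intro: absv_add_le)

text \<open>The ultrametric inequality replaces the convolution sum by its largest term, so no
  factor \<open>n + 1\<close> appears.\<close>

lemma fps_bounded_mult:
  assumes F: "fps_bounded M r F" and G: "fps_bounded M' r G" and "0 \<le> r"
  shows "fps_bounded (M * M') r (F * G)"
  unfolding fps_bounded_def
proof
  fix n
  have M: "0 \<le> M" "0 \<le> M'"
    using order_trans[OF absv_nonneg fps_boundedD[OF F, of 0]]
      order_trans[OF absv_nonneg fps_boundedD[OF G, of 0]] by auto
  have "absv (fps_nth F i * fps_nth G (n - i)) \<le> M * M' * r ^ n" if "i \<le> n" for i
  proof -
    have "absv (fps_nth F i * fps_nth G (n - i)) \<le> (M * r ^ i) * (M' * r ^ (n - i))"
      using F G by (intro absv_mult_le fps_boundedD)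
    also have "\<dots> = M * M' * r ^ n"
      using that power_add[of r i "n - i"] by (simp add: mult_ac)
    finally show ?thesis .
  qed
  then show "absv (fps_nth (F * G) n) \<le> M * M' * r ^ n"
    using M \<open>0 \<le> r\<close> unfolding fps_mult_nth by (intro absv_sum_le) auto
qed

lemma fps_bounded_power:
  assumes "fps_bounded M r F" "0 \<le> r"
  shows "fps_bounded (M ^ k) r (F ^ k)"
  using assms by (induction k) (auto intro: fps_bounded_mult fps_bounded_1)

lemma fps_bounded_sum:
  assumes "\<And>i. i \<in> I \<Longrightarrow> fps_bounded M r (F i)" "0 \<le> M" "0 \<le> r"
  shows "fps_bounded M r (\<Sum>i\<in>I. F i)"
  using assms
  by (induction I rule: infinite_finite_induct) (auto intro: fps_bounded_add)

lemma fps_bounded_const_mult: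
  assumes "absv c \<le> C" "fps_bounded M r F"
  shows "fps_bounded (C * M) r (fps_const c * F)"
  using assms absv_mult_le unfolding fps_bounded_def by (metis fps_mult_left_const_nth mult.assoc)

end

section \<open>The absolute value on integers and Fermat's little theorem\<close>

locale padic_absv = nonarch_absv +
  fixes p :: nat
  assumes prime_p: "Factorial_Ring.prime p"
    and absv_p: "absv (of_nat p) = 1 / real p"
begin

lemma p_gt_1: "p > 1"
  using prime_p by (rule prime_gt_1_nat)

lemma absv_of_int_dvd:
  assumes "int p dvd m"
  shows "absv (of_int m) \<le> 1 / p"
proof -
  obtain k where "m = int p * k"
    using assms by blast
  then show ?thesis
    using absv_mult_le[of "of_nat p" "1 / p" "of_int k" 1] absv_p absv_of_int_le by simp
qed

text \<open>In a Bezout relation \<open>a * p + b * m = 1\<close> both summands would have absolute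
  value below 1 if \<open>m\<close> did.\<close>

lemma absv_of_int_coprime:
  assumes "\<not> int p dvd m"
  shows "absv (of_int m) = 1"
proof (rule antisym[OF absv_of_int_le], rule ccontr)
  assume "\<not> 1 \<le> absv (of_int m)"
  moreover have "coprime (int p) m"
    using prime_p assms by (simp add: prime_imp_coprime)
  then have "gcd (int p) m = 1"
    by simp
  then obtain a b where ab: "a * int p + b * m = 1"
    using bezout_int[of "int p" m] by auto
  have "absv (of_int a * of_nat p) \<le> 1 * (1 / p)"
    by (intro absv_mult_le absv_of_int_le) (simp add: absv_p)
  then have "absv (of_int a * of_nat p) < 1"
    using p_gt_1 by (elim le_less_trans) simp
  moreover have "absv (of_int b * of_int m) \<le> 1 * absv (of_int m)"
    by (intro absv_mult_le absv_of_int_le order_refl)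
  ultimately have "absv (of_int a * of_nat p + of_int b * of_int m) < 1"
    by (intro absv_add_less) auto
  moreover have "of_int a * of_nat p + of_int b * of_int m = (1 :: 'a)"
    using arg_cong[OF ab, of "of_int :: int \<Rightarrow> 'a"] by simp
  ultimately show False
    by simp
qed

lemma absv_of_nat_coprime: "\<not> p dvd n \<Longrightarrow> absv (of_nat n) = 1"
  using absv_of_int_coprime[of "int n"] by simp

text \<open>Fermat's little theorem extends to \<open>p\<close>-integral fractions: the denominator
  is a unit, and the cleared numerator combines the Fermat differences of \<open>m\<close> and
  \<open>k\<close>.\<close>

lemma Rats_fermat:
  assumes "x \<in> \<rat>" "absv x \<le> 1"
  shows "absv (x ^ p - x) \<le> 1 / p"
proof -
  obtain m k :: int where mk: "k > 0" "coprime m k" "x = of_int m / of_int k"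
    using \<open>x \<in> \<rat>\<close> by (rule Rats_cases')
  \<comment> \<open>If \<open>p\<close> divided \<open>k\<close>, then \<open>m\<close> would be a
    unit and \<open>|x| * |k| = 1\<close>, against \<open>|x| \<le> 1\<close> and
    \<open>|k| \<le> 1 / p\<close>.\<close>
  have k: "\<not> int p dvd k"
  proof
    assume "int p dvd k"
    then have "\<not> int p dvd m"
      using coprime_common_divisor[OF mk(2), of "int p"] p_gt_1 by auto
    then have "absv x * absv (of_int k) = 1"
      using mk(1,3) absv_of_int_coprime by (simp flip: absv_mult)
    moreover have "absv x * absv (of_int k) \<le> 1 * (1 / p)"
      using assms(2) absv_of_int_dvd[OF \<open>int p dvd k\<close>] by (intro mult_mono) auto
    moreover have "1 / real p < 1"
      using p_gt_1 by simp
    ultimately show False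
      by linarith
  qed
  have fermat: "int p dvd a ^ p - a" for a :: int
  proof (cases "int p dvd a")
    case True
    then show ?thesis
      using p_gt_1 by (intro dvd_diff dvd_trans[OF True dvd_power]) auto
  next
    case False
    then have "[a ^ (p - 1) = 1] (mod int p)"
      using residues.euler_theorem[of "int p" a] prime_p p_gt_1 prime_imp_coprime[of "int p" a]
      by (simp add: residues_def totient_prime coprime_commute)
    then have "[a * a ^ (p - 1) = a * 1] (mod int p)"
      by (rule cong_scalar_left)
    then show ?thesis
      using p_gt_1 by (simp add: cong_iff_dvd_diff flip: power_Suc)
  qed
  have "x ^ p - x = of_int ((m ^ p - m) * k - m * (k ^ p - k)) / of_int (k ^ p * k)"
    unfolding mk(3) using mk(1) by (simp add: field_simps power_divide)
  moreover have "absv (of_int (k ^ p * k)) = 1"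
    using absv_of_int_coprime[OF k] by (simp add: absv_mult absv_power)
  moreover have "absv (of_int ((m ^ p - m) * k - m * (k ^ p - k))) \<le> 1 / p"
    by (intro absv_of_int_dvd dvd_diff dvd_mult[OF fermat] dvd_mult2[OF fermat])
  ultimately show ?thesis
    by (simp add: absv_divide)
qed

end

section \<open>The Artin-Hasse exponential\<close>

lemma add_power_prime_diff:
  fixes x y :: "'a :: comm_ring_1"
  assumes "p > 0"
  shows "(x + y) ^ p - x ^ p - y ^ p = (\<Sum>k\<in>{0<..<p}. of_nat (p choose k) * x ^ k * y ^ (p - k))"
proof -
  have "{..p} = insert 0 (insert p {0<..<p})"
    using assms by auto
  then show ?thesis
    using assms by (simp add: binomial_ring)
qed

text \<open>The coefficient of \<open>X^m\<close> in the equation expresses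
  \<open>(m + 1) y_(m+1)\<close> through \<open>y_0, ..., y_m\<close>, which vanish by
  induction.\<close>

lemma fps_linear_ode_unique:
  fixes y h :: "'a :: field_char_0 fps"
  assumes "fps_deriv y = h * y" "fps_nth y 0 = 0"
  shows "y = 0"
proof -
  have "fps_nth y n = 0" for n
  proof (induction n rule: less_induct)
    case (less n)
    show ?case
    proof (cases n)
      case (Suc m)
      have "of_nat (Suc m) * fps_nth y (Suc m) = fps_nth (h * y) m"
        using fps_deriv_nth[of y m] assms(1) by simp
      also have "\<dots> = 0"
        using less Suc by (auto simp: fps_mult_nth intro!: sum.neutral)
      finally show ?thesis
        unfolding Suc by (simp del: of_nat_Suc)
    qed (use assms in simp)
  qed
  then show ?thesis
    by (simp add: fps_eq_iff)
qed

text \<open>Both sides solve \<open>y' = (f + g)' y\<close> with constant term 1, so their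
  difference is the zero solution.\<close>

lemma fps_exp_compose_add:
  fixes f g :: "'a :: field_char_0 fps"
  assumes "fps_nth f 0 = 0" "fps_nth g 0 = 0"
  shows "fps_exp 1 oo (f + g) = (fps_exp 1 oo f) * (fps_exp 1 oo g)"
proof -
  have "(fps_exp 1 oo (f + g)) - (fps_exp 1 oo f) * (fps_exp 1 oo g) = 0"
    using assms
    by (intro fps_linear_ode_unique[where h = "fps_deriv (f + g)"])
       (simp_all add: fps_compose_deriv algebra_simps)
  then show ?thesis
    by simp
qed

lemma fps_exp_compose_of_nat_mult:
  fixes f :: "'a :: field_char_0 fps"
  assumes "fps_nth f 0 = 0"
  shows "fps_exp 1 oo (of_nat n * f) = (fps_exp 1 oo f) ^ n"
proof (induction n)
  case (Suc n)
  then show ?case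
    using assms fps_exp_compose_add[of f "of_nat n * f"] by (simp add: algebra_simps)
qed simp

section \<open>The Artin-Hasse series and its functional equation\<close>

definition artin_hasse_log :: "nat \<Rightarrow> 'a :: field_char_0 fps" where
  "artin_hasse_log p = Abs_fps (\<lambda>n. if \<exists>k. n = p ^ k then 1 / of_nat n else 0)"

definition artin_hasse :: "nat \<Rightarrow> 'a :: field_char_0 fps" where
  "artin_hasse p = fps_exp 1 oo artin_hasse_log p"

lemma artin_hasse_log_nth_0 [simp]: "p > 0 \<Longrightarrow> fps_nth (artin_hasse_log p) 0 = 0"
  by (simp add: artin_hasse_log_def)

text \<open>Substituting \<open>X^p\<close> into \<open>L\<close> shifts the summation index, so
  \<open>L(X^p) = p (L - X)\<close>; the term lost is the one for \<open>k = 0\<close>.\<close>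

lemma artin_hasse_log_functional_eq:
  assumes "p > 1"
  shows "of_nat p * artin_hasse_log p =
    (artin_hasse_log p oo fps_X ^ p) + fps_const (of_nat p :: 'a :: field_char_0) * fps_X"
proof (rule fps_ext)
  fix n
  let ?L = "artin_hasse_log p :: 'a fps"
  have rhs: "fps_nth ((?L oo fps_X ^ p) + fps_const (of_nat p) * fps_X) n =
     (if p dvd n then fps_nth ?L (n div p) else 0) + (if n = 1 then of_nat p else 0)"
    using assms by (simp add: fps_nth_compose_X_power)
  show "fps_nth (of_nat p * ?L) n = fps_nth ((?L oo fps_X ^ p) + fps_const (of_nat p) * fps_X) n"
  proof (cases "p dvd n")
    case True
    then obtain m where m: "n = p * m"
      by blast
    have "(\<exists>k. p * m = p ^ k) \<longleftrightarrow> (\<exists>k. m = p ^ k)"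
    proof
      assume "\<exists>k. p * m = p ^ k"
      then obtain k where "p * m = p ^ k"
        by blast
      then show "\<exists>k. m = p ^ k"
        using assms by (cases k) auto
    next
      assume "\<exists>k. m = p ^ k"
      then show "\<exists>k. p * m = p ^ k"
        by (metis power_Suc)
    qed
    then show ?thesis
      unfolding rhs unfolding m using assms by (auto simp: artin_hasse_log_def)
  next
    case False
    then have "n = 1" if "n = p ^ k" for k
      using that by (cases k) auto
    then have "(\<exists>k. n = p ^ k) \<longleftrightarrow> n = 1"
      by (metis power_0)
    then show ?thesis
      unfolding rhs using False by (auto simp: artin_hasse_log_def)
  qed
qed

text \<open>Exponentiating the equation for \<open>L\<close> compares \<open>E^p\<close> with
  \<open>E(X^p)\<close>, the input to Dwork's argument.\<close>

lemma artin_hasse_functional_eq: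
  assumes "p > 1"
  shows "artin_hasse p ^ p = (artin_hasse p oo fps_X ^ p) * fps_exp (of_nat p :: 'a :: field_char_0)"
proof -
  let ?L = "artin_hasse_log p :: 'a fps"
  have "artin_hasse p ^ p = fps_exp 1 oo (of_nat p * ?L)"
    using assms by (simp add: artin_hasse_def fps_exp_compose_of_nat_mult)
  also have "\<dots> = (fps_exp 1 oo (?L oo fps_X ^ p)) * (fps_exp 1 oo (fps_const (of_nat p) * fps_X))"
    unfolding artin_hasse_log_functional_eq[OF assms]
    using assms by (intro fps_exp_compose_add) (auto simp: fps_nth_compose_X_power)
  also have "fps_exp 1 oo (?L oo fps_X ^ p) = artin_hasse p oo fps_X ^ p"
    using assms by (simp add: artin_hasse_def fps_compose_assoc)
  finally show ?thesis
    by simp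
qed

section \<open>Power series with coefficients in a subalgebra over the rationals\<close>

definition fps_coeffs_in :: "'a set \<Rightarrow> 'a :: field_char_0 fps set" where
  "fps_coeffs_in S = {F. \<forall>n. fps_nth F n \<in> S}"

text \<open>Used with \<open>\<rat>\<close>, to see that the Artin-Hasse coefficients are rational,
  and with a complete finite extension of \<open>Qp absv\<close>, which then contains all partial
  sums.\<close>

locale rat_subalgebra =
  fixes S :: "'a :: field_char_0 set"
  assumes Rats_subset: "\<rat> \<subseteq> S"
    and add_closed: "x \<in> S \<Longrightarrow> y \<in> S \<Longrightarrow> x + y \<in> S"
    and mult_closed: "x \<in> S \<Longrightarrow> y \<in> S \<Longrightarrow> x * y \<in> S"
begin

lemma sum_closed: "(\<And>i. i \<in> I \<Longrightarrow> f i \<in> S) \<Longrightarrow> sum f I \<in> S"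
  using Rats_subset by (induction I rule: infinite_finite_induct) (auto intro: add_closed)

lemma power_closed: "x \<in> S \<Longrightarrow> x ^ n \<in> S"
  using Rats_subset by (induction n) (auto intro: mult_closed)

lemma fps_mult_closed:
  "F \<in> fps_coeffs_in S \<Longrightarrow> G \<in> fps_coeffs_in S \<Longrightarrow> F * G \<in> fps_coeffs_in S"
  by (auto simp: fps_coeffs_in_def fps_mult_nth intro!: sum_closed mult_closed)

lemma fps_power_closed: "F \<in> fps_coeffs_in S \<Longrightarrow> F ^ n \<in> fps_coeffs_in S"
proof (induction n)
  case 0
  then show ?case
    using Rats_subset by (auto simp: fps_coeffs_in_def)
qed (auto intro: fps_mult_closed)

lemma fps_compose_closed:
  "F \<in> fps_coeffs_in S \<Longrightarrow> G \<in> fps_coeffs_in S \<Longrightarrow> F oo G \<in> fps_coeffs_in S"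
  using fps_power_closed[of G]
  by (auto simp: fps_coeffs_in_def fps_compose_nth intro!: sum_closed mult_closed)

lemma fps_exp_compose_closed: "G \<in> fps_coeffs_in S \<Longrightarrow> fps_exp 1 oo G \<in> fps_coeffs_in S"
proof (rule fps_compose_closed)
  have "1 / of_nat (fact n) \<in> (\<rat> :: 'a set)" for n
    by (intro Rats_divide Rats_1 Rats_of_nat)
  then show "fps_exp 1 \<in> fps_coeffs_in S"
    using Rats_subset by (auto simp: fps_coeffs_in_def simp del: of_nat_fact)
qed

end

text \<open>Rationality is what makes the congruence of \<open>c ^ p\<close> and \<open>c\<close>
  modulo \<open>p\<close> applicable to the coefficients.\<close>

lemma artin_hasse_nth_Rats: "fps_nth (artin_hasse p) n \<in> \<rat>"
proof -
  interpret rat_subalgebra "\<rat> :: 'a set"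
    by unfold_locales auto
  have "artin_hasse_log p \<in> fps_coeffs_in (\<rat> :: 'a set)"
    by (auto simp: fps_coeffs_in_def artin_hasse_log_def)
  then show ?thesis
    using fps_exp_compose_closed by (auto simp: artin_hasse_def fps_coeffs_in_def)
qed

section \<open>Congruences modulo \<open>p\<close>, factorials and integrality\<close>

context padic_absv
begin

lemma absv_choose_le:
  assumes "0 < k" "k < p"
  shows "absv (of_nat (p choose k)) \<le> 1 / p"
proof -
  have "p dvd (p choose k)"
    using assms prime_p by (intro dvd_choose_prime) auto
  then show ?thesis
    using absv_of_int_dvd[of "int (p choose k)"] by simp
qed

lemma fps_bounded_add_power_p:
  assumes "fps_bounded 1 r F" "fps_bounded 1 r G" "0 \<le> r"
  shows "fps_bounded (1 / p) r ((F + G) ^ p - F ^ p - G ^ p)"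
proof -
  have "fps_bounded (1 / p) r (of_nat (p choose k) * F ^ k * G ^ (p - k))"
    if k: "k \<in> {0<..<p}" for k
  proof -
    have "fps_bounded 1 r (F ^ k * G ^ (p - k))"
      using fps_bounded_mult[OF fps_bounded_power[OF assms(1,3), of k]
          fps_bounded_power[OF assms(2,3), of "p - k"] assms(3)] by simp
    then show ?thesis
      using fps_bounded_const_mult[OF absv_choose_le[of k]] k
      by (fastforce simp: fps_of_nat mult.assoc)
  qed
  then show ?thesis
    using assms p_gt_1 by (subst add_power_prime_diff) (auto intro!: fps_bounded_sum)
qed

text \<open>Induction on the truncation length. A further monomial \<open>c * X^n\<close> leaves
  three errors divisible by \<open>p\<close>: the middle binomial terms, the error of the shorter
  truncation, and \<open>c ^ p - c\<close> by Fermat.\<close>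

lemma fps_bounded_frobenius_cutoff:
  assumes "\<And>i. i < n \<Longrightarrow> fps_nth F i \<in> \<rat> \<and> absv (fps_nth F i) \<le> 1"
  shows "fps_bounded (1 / p) 1 (fps_cutoff n F ^ p - (fps_cutoff n F oo fps_X ^ p))"
  using assms
proof (induction n)
  case 0
  then show ?case
    using p_gt_1 by (simp add: zero_power)
next
  case (Suc n)
  define A where "A = fps_cutoff n F"
  define c where "c = fps_nth F n"
  have c: "c \<in> \<rat>" "absv c \<le> 1"
    using Suc.prems by (auto simp: c_def)
  have eq: "fps_cutoff (Suc n) F = A + fps_const c * fps_X ^ n"
    by (auto simp: fps_eq_iff A_def c_def less_Suc_eq)
  have X: "fps_nth (fps_X ^ p :: 'a fps) 0 = 0"
    using p_gt_1 by simp
  have "fps_bounded (1 / p) 1 ((A + fps_const c * fps_X ^ n) ^ p - A ^ p - (fps_const c * fps_X ^ n) ^ p)"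
    using Suc.prems c by (intro fps_bounded_add_power_p) (auto simp: fps_bounded_def A_def)
  moreover have "fps_bounded (1 / p) 1 (A ^ p - (A oo fps_X ^ p))"
    using Suc by (simp add: A_def)
  moreover have "fps_bounded (1 / p) 1 (fps_const (c ^ p - c) * fps_X ^ (p * n))"
    using Rats_fermat[OF c] by (auto simp: fps_bounded_def simp del: fps_const_sub)
  ultimately have "fps_bounded (1 / p) 1 (((A + fps_const c * fps_X ^ n) ^ p - A ^ p -
      (fps_const c * fps_X ^ n) ^ p) + (A ^ p - (A oo fps_X ^ p)) +
      fps_const (c ^ p - c) * fps_X ^ (p * n))"
    by (intro fps_bounded_add)
  also have "\<dots> = (A + fps_const c * fps_X ^ n) ^ p - ((A + fps_const c * fps_X ^ n) oo fps_X ^ p)"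
    using X by (simp add: fps_compose_add_distrib fps_compose_mult_distrib fps_X_power_compose
        power_mult_distrib algebra_simps flip: fps_const_sub power_mult)
  finally show ?case
    unfolding eq .
qed

text \<open>The multiples of \<open>p\<close> among \<open>1, ..., p * m + r\<close> are
  \<open>p, 2 * p, ..., m * p\<close>, contributing \<open>p ^ m * m!\<close>; the other factors are
  units.\<close>

lemma absv_fact_mult_p:
  "r < p \<Longrightarrow> absv (fact (p * m + r)) = (1 / p) ^ m * absv (fact m)"
proof (induction m arbitrary: r)
  case (0 r)
  then show ?case
  proof (induction r)
    case (Suc r)
    then show ?case
      using absv_of_nat_coprime[of "Suc r"] by (simp add: absv_mult nat_dvd_not_less del: of_nat_Suc)
  qed simp
next
  case (Suc m)
  show ?case
    using Suc.prems
  proof (induction r)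
    case 0
    have "p * Suc m = Suc (p * m + (p - 1))"
      using p_gt_1 by simp
    then have "fact (p * Suc m) = (of_nat (p * Suc m) * fact (p * m + (p - 1)) :: 'a)"
      by (metis fact_Suc)
    then have "fact (p * Suc m) = (of_nat p * of_nat (Suc m) * fact (p * m + (p - 1)) :: 'a)"
      by (simp only: of_nat_mult)
    then show ?case
      using Suc.IH[of "p - 1"] p_gt_1 by (simp add: absv_mult absv_p del: of_nat_Suc)
  next
    case (Suc r)
    then have "\<not> p dvd p * Suc m + Suc r"
      by (metis dvd_add_right_iff dvd_triv_left nat_dvd_not_less zero_less_Suc)
    then show ?case
      using Suc absv_of_nat_coprime[of "p * Suc m + Suc r"]
      by (simp add: absv_mult del: of_nat_Suc of_nat_add of_nat_mult mult_Suc_right)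
  qed
qed

text \<open>Legendre's estimate \<open>v(n!) \<le> (n - 1) / (p - 1)\<close> for
  \<open>n > 0\<close>, as \<open>\<theta>\<close> has valuation \<open>1 / (p - 1)\<close>. Strong
  induction passes from \<open>n\<close> to \<open>n div p\<close>; for \<open>n = 0\<close> the
  truncated exponent is 0.\<close>

lemma absv_fact_ge:
  assumes "0 \<le> \<theta>" "\<theta> ^ (p - 1) = 1 / p"
  shows "\<theta> ^ (n - 1) \<le> absv (fact n)"
proof (induction n rule: less_induct)
  case (less n)
  have \<theta>: "\<theta> \<le> 1"
    using assms p_gt_1 power_le_one_iff[of \<theta> "p - 1"] by simp
  define m where "m = n div p"
  have n: "n = p * m + n mod p" "n mod p < p"
    using p_gt_1 by (auto simp: m_def)
  have fact_n: "absv (fact n) = (1 / p) ^ m * absv (fact m)"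
    using absv_fact_mult_p[OF n(2), of m] n(1) by simp
  show ?case
  proof (cases "m = 0")
    case True
    then show ?thesis
      using fact_n assms \<theta> by (simp add: power_le_one)
  next
    case False
    then have "m < n"
      using p_gt_1 by (auto simp: m_def intro!: div_less_dividend Nat.gr0I)
    \<comment> \<open>The factor \<open>(1 / p) ^ m\<close> is
      \<open>\<theta> ^ ((p - 1) * m)\<close> and \<open>m!\<close> accounts for
      \<open>m - 1\<close> more; the total \<open>p * m - 1\<close> is at most
      \<open>n - 1\<close>.\<close>
    have "(p - 1) * m + (m - 1) = p * m - 1"
      using False p_gt_1 by (cases p) auto
    then have "\<theta> ^ (p * m - 1) = (1 / p) ^ m * \<theta> ^ (m - 1)"
      by (simp flip: assms(2) power_mult power_add)
    also have "\<dots> \<le> absv (fact n)"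
      unfolding fact_n using less[OF \<open>m < n\<close>] by (intro mult_left_mono) auto
    finally show ?thesis
      using n(1) \<theta> assms by (elim order_trans[rotated]) (intro power_decreasing, auto)
  qed
qed

lemma exists_fact_bound: "\<exists>\<theta>>0. \<theta> \<le> 1 \<and> \<theta> ^ (p - 1) = 1 / p"
  using p_gt_1 by (intro exI[of _ "root (p - 1) (1 / p)"]) auto

text \<open>Since \<open>1 / p \<le> \<theta>\<close>, already \<open>p ^ (n - 1) / n!\<close> is
  integral, which leaves one factor \<open>p\<close>.\<close>

lemma absv_fps_exp_p_le:
  assumes "n > 0"
  shows "absv (fps_nth (fps_exp (of_nat p)) n) \<le> 1 / p"
proof -
  obtain \<theta> :: real where \<theta>: "\<theta> > 0" "\<theta> \<le> 1" "\<theta> ^ (p - 1) = 1 / p"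
    using exists_fact_bound by blast
  have "1 / p \<le> \<theta>"
    using \<theta> power_decreasing[of 1 "p - 1" \<theta>] p_gt_1 by simp
  then have "(1 / p) ^ (n - 1) \<le> \<theta> ^ (n - 1)"
    by (intro power_mono) auto
  also have "\<dots> \<le> absv (fact n)"
    using \<theta> by (intro absv_fact_ge) auto
  finally have "(1 / p) ^ (n - 1) \<le> absv (fact n)" .
  then have "1 / p * (1 / p) ^ (n - 1) \<le> 1 / p * absv (fact n)"
    by (intro mult_left_mono) auto
  also have "1 / p * (1 / p) ^ (n - 1) = (1 / p) ^ n"
    using assms by (cases n) auto
  finally have "(1 / p) ^ n \<le> 1 / p * absv (fact n)" .
  moreover have "absv (fact n) > 0"
    using absv_nonneg[of "fact n"] absv_eq_0_iff[of "fact n"] by (simp add: less_le del: absv_nonneg absv_eq_0_iff)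
  ultimately show ?thesis
    by (simp add: absv_divide absv_power absv_p pos_divide_le_eq)
qed

text \<open>
  Dwork's argument: \<open>F^p = F(X^p) exp(p X)\<close> is congruent to \<open>F(X^p)\<close> modulo \<open>p\<close>, and so is \<open>A^p\<close> to
  \<open>A(X^p)\<close> for the truncation \<open>A\<close> of \<open>F\<close> below \<open>X^n\<close>, by Fermat. The coefficients of \<open>X^n\<close> in \<open>F^p\<close>
  and \<open>A^p\<close> differ by \<open>p\<close> times that of \<open>F\<close>.
\<close>

lemma artin_hasse_integral: "absv (fps_nth (artin_hasse p) n) \<le> 1"
proof (induction n rule: less_induct)
  case (less n)
  define F :: "'a fps" where "F = artin_hasse p"
  have F0: "fps_nth F 0 = 1"
    by (simp add: F_def artin_hasse_def)
  show ?case
  proof (cases "n = 0")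
    case True
    then show ?thesis
      using F0 by (simp add: F_def)
  next
    case False
    define A where "A = fps_cutoff n F"
    define T where "T = (\<Sum>i<p. F ^ i * A ^ (p - 1 - i))"
    \<comment> \<open>Each of the \<open>p\<close> summands has constant term 1, because
      \<open>n > 0\<close> makes \<open>A\<close> inherit the constant term of
      \<open>F\<close>.\<close>
    have T0: "fps_nth T 0 = of_nat p"
      using F0 False by (simp add: T_def fps_sum_nth A_def fps_nth_power_0)
    have "F ^ p - A ^ p = (F - A) * T"
      using diff_power_eq_sum[of F "p - 1" A] p_gt_1 by (simp add: T_def)
    also have "F - A = fps_X ^ n * fps_shift n F"
      unfolding A_def by (metis add_diff_cancel_right' fps_shift_cutoff')
    finally have "fps_nth (F ^ p - A ^ p) n = fps_nth (fps_X ^ n * (fps_shift n F * T)) n"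
      by (simp only: mult.assoc)
    also have "\<dots> = fps_nth F n * of_nat p"
      by (simp add: fps_X_power_mult_nth T0)
    finally have 1: "fps_nth F n * of_nat p = fps_nth (F ^ p) n - fps_nth (A ^ p) n"
      by simp
    have A: "fps_bounded (1 / p) 1 (A ^ p - (A oo fps_X ^ p))"
      unfolding A_def using less artin_hasse_nth_Rats
      by (intro fps_bounded_frobenius_cutoff) (auto simp: F_def)
    have 2: "absv (fps_nth (A ^ p) n - fps_nth (A oo fps_X ^ p) n) \<le> 1 / p"
      using fps_boundedD[OF A, of n] by simp
    have lt: "m div p < n" if "m \<le> n" for m
      using that False p_gt_1 by (meson div_le_mono div_less_dividend le_less_trans not_gr0)
    \<comment> \<open>At most the index \<open>n div p < n\<close> is involved, where
      \<open>A\<close> and \<open>F\<close> agree.\<close>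
    have 3: "fps_nth (A oo fps_X ^ p) n = fps_nth (F oo fps_X ^ p) n"
      using lt[of n] by (simp add: fps_nth_compose_X_power A_def)
    have "fps_nth (F ^ p) n = (\<Sum>i=0..n. fps_nth (F oo fps_X ^ p) i * fps_nth (fps_exp (of_nat p)) (n - i))"
      unfolding F_def artin_hasse_functional_eq[OF p_gt_1] fps_mult_nth ..
    also have "\<dots> = fps_nth (F oo fps_X ^ p) n +
        (\<Sum>i<n. fps_nth (F oo fps_X ^ p) i * fps_nth (fps_exp (of_nat p)) (n - i))"
      by (simp add: atLeast0AtMost lessThan_Suc_atMost [symmetric] add.commute)
    finally have 4: "fps_nth (F ^ p) n - fps_nth (F oo fps_X ^ p) n =
        (\<Sum>i<n. fps_nth (F oo fps_X ^ p) i * fps_nth (fps_exp (of_nat p)) (n - i))"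
      by simp
    have "absv (fps_nth (F oo fps_X ^ p) i * fps_nth (fps_exp (of_nat p)) (n - i)) \<le> 1 * (1 / p)"
      if "i < n" for i
      using that less lt[of i]
      by (intro absv_mult_le absv_fps_exp_p_le) (auto simp: fps_nth_compose_X_power F_def)
    then have "absv (fps_nth (F ^ p) n - fps_nth (F oo fps_X ^ p) n) \<le> 1 / p"
      unfolding 4 by (intro absv_sum_le) auto
    then have "absv (fps_nth F n * of_nat p) \<le> 1 / p"
      using absv_diff_le[OF _ 2] unfolding 1 3 by fastforce
    then show ?thesis
      using p_gt_1 by (simp add: absv_mult absv_p F_def field_simps)
  qed
qed

text \<open>The constant \<open>\<theta>\<close> in the bound for \<open>g\<close> pays for the
  denominators: \<open>g ^ i\<close> is bounded by \<open>\<theta> ^ i * r ^ n\<close>, and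
  \<open>\<theta> ^ i \<le> |i!|\<close>.\<close>

lemma fps_bounded_exp_compose:
  assumes \<theta>: "0 < \<theta>" "\<theta> ^ (p - 1) = 1 / p" and g: "fps_bounded \<theta> r g" and r: "0 \<le> r"
  shows "fps_bounded 1 r (fps_exp 1 oo g)"
  unfolding fps_bounded_def
proof
  fix n
  have \<theta>1: "\<theta> \<le> 1"
    using \<theta> p_gt_1 power_le_one_iff[of \<theta> "p - 1"] by simp
  have "absv (fps_nth (fps_exp 1) i * fps_nth (g ^ i) n) \<le> r ^ n" for i
  proof -
    have "\<theta> ^ i \<le> \<theta> ^ (i - 1)"
      using \<theta>1 \<theta>(1) by (intro power_decreasing) auto
    also have "\<dots> \<le> absv (fact i)"
      using \<theta> by (intro absv_fact_ge) auto
    finally have "\<theta> ^ i \<le> absv (fact i)" .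
    moreover have "absv (fps_nth (g ^ i) n) \<le> \<theta> ^ i * r ^ n"
      by (intro fps_boundedD fps_bounded_power g r)
    ultimately have "absv (fps_nth (g ^ i) n) \<le> absv (fact i) * r ^ n"
      using r by (meson mult_right_mono order_trans zero_le_power)
    moreover have "absv (fact i) > 0"
      using \<theta>(1) \<open>\<theta> ^ i \<le> absv (fact i)\<close> by (meson less_le_trans zero_less_power)
    ultimately show ?thesis
      by (simp add: absv_divide absv_mult pos_divide_le_eq mult.commute)
  qed
  then show "absv (fps_nth (fps_exp 1 oo g) n) \<le> 1 * r ^ n"
    using r unfolding fps_compose_nth by (intro absv_sum_le) auto
qed

end

section \<open>Completeness of finite extensions of \<open>Q\<^sub>p\<close>\<close>

definition seq_complete :: "('a :: field \<Rightarrow> real) \<Rightarrow> 'a set \<Rightarrow> bool" where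
  "seq_complete absv V \<longleftrightarrow>
    (\<forall>s. range s \<subseteq> V \<longrightarrow> cauchy_seq absv s \<longrightarrow> (\<exists>l\<in>V. converges_to absv s l))"

lemma seq_completeE:
  assumes "seq_complete absv V" "\<And>n. s n \<in> V" "cauchy_seq absv s"
  obtains l where "l \<in> V" "converges_to absv s l"
  using assms unfolding seq_complete_def by blast

section \<open>Cauchy sequences and complete subspaces\<close>

context nonarch_absv
begin

lemma cauchy_seq_dominated:
  assumes s: "cauchy_seq absv s" and "\<And>m n. absv (t m - t n) \<le> c * absv (s m - s n)"
  shows "cauchy_seq absv t"
  unfolding cauchy_seq_def
proof (intro allI impI)
  fix e :: real
  assume "e > 0"
  \<comment> \<open>The constant \<open>c\<close> may fail to be positive, and \<open>e\<close> is
    to be divided by it.\<close>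
  define c' where "c' = max c 1"
  have c': "c' > 0" "\<And>m n. absv (t m - t n) \<le> c' * absv (s m - s n)"
    using assms(2) mult_right_mono[of c c', OF _ absv_nonneg] order_trans
    unfolding c'_def by (auto, blast)
  have "e / c' > 0"
    using \<open>e > 0\<close> c' by simp
  then obtain N where N: "\<And>m n. m \<ge> N \<Longrightarrow> n \<ge> N \<Longrightarrow> absv (s m - s n) < e / c'"
    using s unfolding cauchy_seq_def by meson
  have "absv (t m - t n) < e" if "m \<ge> N" "n \<ge> N" for m n
    using c'(2)[of m n] N[OF that] c'(1) by (simp add: pos_less_divide_eq mult.commute)
  then show "\<exists>N. \<forall>m\<ge>N. \<forall>n\<ge>N. absv (t m - t n) < e"
    by blast
qed

lemma cauchy_seq_diff:
  assumes "cauchy_seq absv s" "cauchy_seq absv t"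
  shows "cauchy_seq absv (\<lambda>n. s n - t n)"
  unfolding cauchy_seq_def
proof (intro allI impI)
  fix e :: real
  assume "e > 0"
  then obtain M N where
    M: "\<And>m n. m \<ge> M \<Longrightarrow> n \<ge> M \<Longrightarrow> absv (s m - s n) < e" and
    N: "\<And>m n. m \<ge> N \<Longrightarrow> n \<ge> N \<Longrightarrow> absv (t m - t n) < e"
    using assms unfolding cauchy_seq_def by meson
  have "absv ((s m - t m) - (s n - t n)) < e" if "m \<ge> max M N" "n \<ge> max M N" for m n
    using absv_diff_less[OF M[of m n] N[of m n]] that by (simp add: algebra_simps)
  then show "\<exists>N. \<forall>m\<ge>N. \<forall>n\<ge>N. absv ((s m - t m) - (s n - t n)) < e"
    by blast
qed

lemma cauchy_seq_of_tendsto_0: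
  assumes "(\<lambda>n. absv (s n - l)) \<longlonglongrightarrow> 0"
  shows "cauchy_seq absv s"
  unfolding cauchy_seq_def
proof (intro allI impI)
  fix e :: real
  assume "e > 0"
  then obtain N where N: "\<And>n. n \<ge> N \<Longrightarrow> absv (s n - l) < e"
    using order_tendstoD(2)[OF assms] by (auto simp: eventually_sequentially)
  have "absv (s m - s n) < e" if "m \<ge> N" "n \<ge> N" for m n
    using absv_diff_less[OF N[OF that(1)] N[OF that(2)]] by simp
  then show "\<exists>N. \<forall>m\<ge>N. \<forall>n\<ge>N. absv (s m - s n) < e"
    by blast
qed

text \<open>A block of an ultrametric sum is no larger than its largest term, so terms tending to 0
  suffice.\<close>

lemma cauchy_seq_partial_sums:
  assumes "(\<lambda>n. absv (a n)) \<longlonglongrightarrow> 0"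
  shows "cauchy_seq absv (\<lambda>N. \<Sum>n<N. a n)"
  unfolding cauchy_seq_def
proof (intro allI impI)
  fix e :: real
  assume "e > 0"
  then obtain N where N: "\<And>n. n \<ge> N \<Longrightarrow> absv (a n) < e / 2"
    using order_tendstoD(2)[OF assms, of "e / 2"] unfolding eventually_sequentially by auto
  have *: "absv ((\<Sum>i<m. a i) - (\<Sum>i<n. a i)) < e" if "n \<ge> N" "n \<le> m" for m n
  proof -
    have "absv (\<Sum>i\<in>{n..<m}. a i) \<le> e / 2"
      using N that \<open>e > 0\<close> by (intro absv_sum_le) (auto intro: less_imp_le)
    moreover have "(\<Sum>i<m. a i) - (\<Sum>i<n. a i) = (\<Sum>i\<in>{n..<m}. a i)"
      using that by (simp add: sum_diff_nat_ivl flip: atLeast0LessThan)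
    ultimately show ?thesis
      using \<open>e > 0\<close> by simp
  qed
  have "absv ((\<Sum>i<m. a i) - (\<Sum>i<n. a i)) < e" if "m \<ge> N" "n \<ge> N" for m n
    using *[of n m] *[of m n] that absv_minus_commute by (metis nle_le)
  then show "\<exists>N. \<forall>m\<ge>N. \<forall>n\<ge>N. absv ((\<Sum>i<m. a i) - (\<Sum>i<n. a i)) < e"
    by blast
qed

text \<open>Otherwise some sequence in \<open>V\<close> converges to \<open>v\<close>; it is Cauchy,
  and its limit in \<open>V\<close> has to be \<open>v\<close>.\<close>

lemma seq_complete_dist_pos:
  assumes "seq_complete absv V" "v \<notin> V"
  obtains \<delta> where "\<delta> > 0" "\<And>x. x \<in> V \<Longrightarrow> \<delta> \<le> absv (v - x)"
proof (rule ccontr)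
  assume "\<not> thesis"
  then have "\<exists>x\<in>V. absv (v - x) < 1 / Suc n" for n
    using that[of "1 / Suc n"] by (meson not_le of_nat_0_less_iff zero_less_Suc zero_less_divide_1_iff)
  then obtain x where x: "\<And>n. x n \<in> V" "\<And>n. absv (v - x n) < 1 / Suc n"
    by metis
  have lim: "(\<lambda>n. absv (x n - v)) \<longlonglongrightarrow> 0"
    using x(2) by (intro tendsto_sandwich[OF _ _ tendsto_const lim_inverse_n'[THEN LIMSEQ_Suc]])
       (auto simp: absv_minus_commute[of _ v] intro!: always_eventually less_imp_le)
  then obtain l where l: "l \<in> V" "converges_to absv x l"
    using seq_completeE[of absv V x, OF assms(1) x(1) cauchy_seq_of_tendsto_0] by blast
  have "(\<lambda>n. max (absv (x n - v)) (absv (x n - l))) \<longlonglongrightarrow> max 0 0"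
    using lim l(2) by (intro tendsto_max) (auto simp: converges_to_def)
  moreover have "absv (v - l) \<le> max (absv (x n - v)) (absv (x n - l))" for n
    using absv_ultrametric[of "v - x n" "x n - l"] absv_minus_commute[of v "x n"] by simp
  ultimately have "absv (v - l) \<le> 0"
    by (intro LIMSEQ_le_const) auto
  then have "v = l"
    using absv_nonneg[of "v - l"] absv_eq_0_iff[of "v - l"] by simp
  then show False
    using l assms by simp
qed

text \<open>The distance \<open>\<delta>\<close> from \<open>v\<close> to \<open>E\<close> gives
  \<open>\<delta> * |k| \<le> |k * v + x|\<close>. Hence the coordinates \<open>k\<close> of a
  Cauchy sequence are Cauchy, so are its components in \<open>E\<close>, and both have
  limits.\<close>

lemma seq_complete_line_extension:
  assumes K: "seq_complete absv K" and E: "seq_complete absv E" and "v \<notin> E"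
    and K_diff: "\<And>x y. x \<in> K \<Longrightarrow> y \<in> K \<Longrightarrow> x - y \<in> K"
    and K_inverse: "\<And>x. x \<in> K \<Longrightarrow> inverse x \<in> K"
    and E_diff: "\<And>x y. x \<in> E \<Longrightarrow> y \<in> E \<Longrightarrow> x - y \<in> E"
    and E_mult: "\<And>k x. k \<in> K \<Longrightarrow> x \<in> E \<Longrightarrow> k * x \<in> E"
  shows "seq_complete absv {k * v + x | k x. k \<in> K \<and> x \<in> E}"
  unfolding seq_complete_def
proof (intro allI impI)
  fix s
  assume "range s \<subseteq> {k * v + x | k x. k \<in> K \<and> x \<in> E}" and s: "cauchy_seq absv s"
  then have "\<forall>n. \<exists>k x. k \<in> K \<and> x \<in> E \<and> s n = k * v + x"
    by blast
  then obtain k x where kx: "\<And>n. k n \<in> K" "\<And>n. x n \<in> E" "\<And>n. s n = k n * v + x n"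
    by metis
  obtain \<delta> where \<delta>: "\<delta> > 0" "\<And>x. x \<in> E \<Longrightarrow> \<delta> \<le> absv (v - x)"
    using seq_complete_dist_pos[OF E \<open>v \<notin> E\<close>] by blast
  have bound: "\<delta> * absv a \<le> absv (a * v + y)" if "a \<in> K" "y \<in> E" for a y
  proof (cases "a = 0")
    case False
    \<comment> \<open>Division by \<open>a\<close> reduces the claim to the distance from
      \<open>v\<close>. Negation is a difference from \<open>0 = y - y\<close>, since closure of
      \<open>E\<close> is given for differences and scalars.\<close>
    have "0 - inverse a * y \<in> E"
      using E_diff[of y y] that by (intro E_diff E_mult K_inverse) auto
    then have "absv a * \<delta> \<le> absv a * absv (v - (0 - inverse a * y))"
      by (intro mult_left_mono \<delta>(2)) auto
    also have "\<dots> = absv (a * (v - (0 - inverse a * y)))"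
      by (simp only: absv_mult)
    also have "a * (v - (0 - inverse a * y)) = a * v + y"
      using False by (simp add: field_simps)
    finally show ?thesis
      by (simp add: mult.commute)
  qed simp
  have "absv (k m - k n) \<le> 1 / \<delta> * absv (s m - s n)" for m n
  proof -
    have "\<delta> * absv (k m - k n) \<le> absv ((k m - k n) * v + (x m - x n))"
      using kx by (intro bound K_diff E_diff)
    also have "(k m - k n) * v + (x m - x n) = s m - s n"
      using kx by (simp add: algebra_simps)
    finally show ?thesis
      using \<delta>(1) by (simp add: field_simps)
  qed
  then have k: "cauchy_seq absv k"
    by (rule cauchy_seq_dominated[OF s])
  have "k m * v - k n * v = v * (k m - k n)" for m n
    by (simp add: algebra_simps)
  then have kv: "cauchy_seq absv (\<lambda>n. k n * v)"
    by (intro cauchy_seq_dominated[OF k, where c = "absv v"]) (simp add: absv_mult)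
  have "x = (\<lambda>n. s n - k n * v)"
    using kx by simp
  then have "cauchy_seq absv x"
    using cauchy_seq_diff[OF s kv] by simp
  then obtain y where y: "y \<in> E" "converges_to absv x y"
    using seq_completeE[of absv E x, OF E kx(2)] by blast
  obtain a where a: "a \<in> K" "converges_to absv k a"
    using seq_completeE[of absv K k, OF K kx(1) k] by blast
  have "(\<lambda>n. max (absv (k n - a) * absv v) (absv (x n - y))) \<longlonglongrightarrow> max (0 * absv v) 0"
    using a y unfolding converges_to_def by (intro tendsto_max tendsto_mult_right)
  then have lim: "(\<lambda>n. max (absv (k n - a) * absv v) (absv (x n - y))) \<longlonglongrightarrow> 0"
    by simp
  have le: "absv (s n - (a * v + y)) \<le> max (absv (k n - a) * absv v) (absv (x n - y))" for n
  proof -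
    have "s n - (a * v + y) = (k n - a) * v + (x n - y)"
      using kx(3)[of n] by (simp add: algebra_simps)
    then show ?thesis
      using absv_ultrametric[of "(k n - a) * v" "x n - y"] by (simp only: absv_mult)
  qed
  have "converges_to absv s (a * v + y)"
    unfolding converges_to_def by (rule Lim_null_comparison[OF always_eventually lim]) (use le in simp)
  then show "\<exists>l\<in>{k * v + x | k x. k \<in> K \<and> x \<in> E}. converges_to absv s l"
    using a y by blast
qed

section \<open>The closure of the rationals as a subfield\<close>

lemma Qp_of_rat: "of_rat r \<in> Qp absv"
  by (auto simp: Qp_def intro!: exI[of _ r])

lemma Qp_approx:
  assumes "x \<in> Qp absv" "e > 0"
  obtains r where "absv (x - of_rat r) < e"
  using assms by (auto simp: Qp_def)

lemma Qp_diff: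
  assumes "x \<in> Qp absv" "y \<in> Qp absv"
  shows "x - y \<in> Qp absv"
  unfolding Qp_def
proof (intro CollectI allI impI)
  fix e :: real
  assume "e > 0"
  with assms obtain r s where "absv (x - of_rat r) < e" "absv (y - of_rat s) < e"
    by (metis Qp_approx)
  then have "absv ((x - of_rat r) - (y - of_rat s)) < e"
    by (rule absv_diff_less)
  then have "absv (x - y - of_rat (r - s)) < e"
    by (simp add: of_rat_diff algebra_simps)
  then show "\<exists>r. absv (x - y - of_rat r) < e" ..
qed

lemma Qp_add:
  assumes "x \<in> Qp absv" "y \<in> Qp absv"
  shows "x + y \<in> Qp absv"
  using Qp_diff[OF assms(1) Qp_diff[OF Qp_of_rat[of 0] assms(2)]] by simp

lemma Qp_mult:
  assumes "x \<in> Qp absv" "y \<in> Qp absv"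
  shows "x * y \<in> Qp absv"
  unfolding Qp_def
proof (intro CollectI allI impI)
  fix e :: real
  assume "e > 0"
  define c where "c = max (max (absv x) (absv y)) 1"
  have c: "absv x \<le> c" "absv y \<le> c" "c > 0"
    by (auto simp: c_def)
  \<comment> \<open>For \<open>x * y - r * s = (x - r) * s + (y - s) * x\<close>: the tolerance
    \<open>e / c\<close> makes both summands small, and the tolerance \<open>c\<close> ensures
    \<open>|s| \<le> c\<close>.\<close>
  have "min (e / c) c > 0"
    using c \<open>e > 0\<close> by simp
  then obtain r s where rs: "absv (x - of_rat r) < min (e / c) c" "absv (y - of_rat s) < min (e / c) c"
    using assms by (metis Qp_approx)
  have "absv (of_rat s) \<le> c"
    using absv_diff_le[OF c(2), of "y - of_rat s"] rs by simp
  then have "absv (x - of_rat r) * absv (of_rat s) \<le> absv (x - of_rat r) * c"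
    by (intro mult_left_mono) auto
  also have "\<dots> < e"
    using rs c by (simp add: pos_less_divide_eq)
  finally have 1: "absv ((x - of_rat r) * of_rat s) < e"
    by (simp add: absv_mult)
  have "absv (y - of_rat s) * absv x \<le> absv (y - of_rat s) * c"
    using c by (intro mult_left_mono) auto
  also have "\<dots> < e"
    using rs c by (simp add: pos_less_divide_eq)
  finally have 2: "absv ((y - of_rat s) * x) < e"
    by (simp add: absv_mult)
  have "absv (x * y - of_rat (r * s)) < e"
    using absv_add_less[OF 1 2] by (simp add: of_rat_mult algebra_simps)
  then show "\<exists>r. absv (x * y - of_rat r) < e" ..
qed

lemma Qp_inverse:
  assumes "x \<in> Qp absv"
  shows "inverse x \<in> Qp absv"
proof (cases "x = 0")
  case True
  then show ?thesis
    using assms by simp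
next
  case False
  then have x: "absv x > 0"
    using absv_nonneg[of x] absv_eq_0_iff[of x] by linarith
  show ?thesis
    unfolding Qp_def
  proof (intro CollectI allI impI)
    fix e :: real
    assume "e > 0"
    \<comment> \<open>The first tolerance forces \<open>|r| = |x|\<close>; then the inverses differ
      by \<open>|x - r| / |x| ^ 2\<close>, which the second controls.\<close>
    then have "min (absv x) (e * absv x ^ 2) > 0"
      using x by (auto intro!: mult_pos_pos zero_less_power)
    then obtain r where r: "absv (x - of_rat r) < min (absv x) (e * absv x ^ 2)"
      using assms Qp_approx by blast
    have absv_r: "absv (of_rat r) = absv x"
      using absv_add_eq[of "- (x - of_rat r)" x] r by (simp del: minus_diff_eq)
    then have "of_rat r \<noteq> (0 :: 'a)"
      using x by (metis absv_0 less_irrefl)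
    then have "inverse x - inverse (of_rat r) = - ((x - of_rat r) / (x * of_rat r))"
      using False by (simp add: field_simps)
    then have "absv (inverse x - inverse (of_rat r)) = absv (x - of_rat r) / absv x ^ 2"
      by (simp add: absv_divide absv_mult absv_r power2_eq_square del: minus_diff_eq)
    also have "\<dots> < e"
      using r False by (simp add: pos_divide_less_eq)
    finally have "absv (inverse x - of_rat (inverse r)) < e"
      by (simp add: of_rat_inverse)
    then show "\<exists>r. absv (inverse x - of_rat r) < e" ..
  qed
qed

lemma subfield_Qp: "subfield (Qp absv) (ring_of_type_algebra :: 'a ring)"
proof -
  let ?R = "ring_of_type_algebra :: 'a ring"
  interpret R: field ?R
    by (rule field_from_type_algebra)
  have inv: "inv\<^bsub>?R\<^esub> x = inverse x" if "x \<noteq> 0" for x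
    using that by (intro R.inv_unique'[symmetric]) (auto simp: ring_of_type_algebra_def)
  have minus: "\<ominus>\<^bsub>?R\<^esub> x = 0 - x" for x
    by (intro R.minus_equality) (auto simp: ring_of_type_algebra_def)
  show ?thesis
  proof (rule R.subfieldI'[OF R.subringI])
    show "\<ominus>\<^bsub>?R\<^esub> x \<in> Qp absv" if "x \<in> Qp absv" for x
      unfolding minus using Qp_diff[OF Qp_of_rat[of 0] that] by simp
  next
    show "inv\<^bsub>?R\<^esub> x \<in> Qp absv" if "x \<in> Qp absv - {\<zero>\<^bsub>?R\<^esub>}" for x
      using that Qp_inverse[of x] inv[of x] by (auto simp: ring_of_type_algebra_def)
  qed (use Qp_of_rat[of 1] in \<open>auto simp: ring_of_type_algebra_def intro: Qp_add Qp_mult\<close>)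
qed

end

text \<open>\<open>ring.eval\<close> reads the leading coefficient first, whence the reversal. This
  carries algebraicity over \<open>Qp absv\<close> to \<open>ring_of_type_algebra\<close>.\<close>

lemma Poly_rev_eq_eval:
  "poly (Poly (rev xs)) x = ring.eval (ring_of_type_algebra :: 'a :: field ring) xs x"
proof -
  interpret R: field "ring_of_type_algebra :: 'a ring"
    by (rule field_from_type_algebra)
  have pow: "y [^]\<^bsub>(ring_of_type_algebra :: 'a ring)\<^esub> n = y ^ n" for y n
    by (induction n) (auto simp: ring_of_type_algebra_def)
  show ?thesis
    by (induction xs) (auto simp: Poly_append poly_monom pow, auto simp: ring_of_type_algebra_def)
qed

section \<open>Finite extensions and a criterion for overconvergence\<close>

context padic_algebraic_closure
begin

sublocale nonarch_absv absv
  using absv_nonneg absv_eq_0_iff absv_mult absv_ultrametric by unfold_locales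

lemma seq_complete_Qp: "seq_complete absv (Qp absv)"
  using Qp_complete unfolding seq_complete_def by blast

text \<open>One line is adjoined at a time, by induction on the dimension. Closure under differences
  and scalars is carried along because each adjunction requires it.\<close>

lemma seq_complete_finite_dimension:
  assumes "ring.dimension (ring_of_type_algebra :: 'a ring) n (Qp absv) E"
  shows "seq_complete absv E"
proof -
  interpret R: field "ring_of_type_algebra :: 'a ring"
    by (rule field_from_type_algebra)
  have "seq_complete absv E \<and> (\<forall>x\<in>E. \<forall>y\<in>E. x - y \<in> E) \<and> (\<forall>k\<in>Qp absv. \<forall>x\<in>E. k * x \<in> E)"
    using assms
  proof (induction n "Qp absv" E rule: R.dimension.induct)
    case zero_dim
    show ?case
      by (auto simp: ring_of_type_algebra_def seq_complete_def converges_to_def image_subset_iff)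
  next
    case (Suc_dim v E n)
    have line: "R.line_extension (Qp absv) v E = {k * v + x | k x. k \<in> Qp absv \<and> x \<in> E}"
      unfolding R.line_extension_def r_coset_def set_add_def set_mult_def
      by (auto simp: ring_of_type_algebra_def)
    have "seq_complete absv (R.line_extension (Qp absv) v E)"
      unfolding line using Suc_dim
      by (intro seq_complete_line_extension seq_complete_Qp Qp_diff Qp_inverse) auto
    moreover have "x - y \<in> R.line_extension (Qp absv) v E"
      if xy: "x \<in> R.line_extension (Qp absv) v E" "y \<in> R.line_extension (Qp absv) v E" for x y
    proof -
      obtain a b c d where "x = a * v + b" "y = c * v + d" "a \<in> Qp absv" "c \<in> Qp absv" "b \<in> E" "d \<in> E"
        using xy unfolding line by blast
      then have "x - y = (a - c) * v + (b - d)" "a - c \<in> Qp absv" "b - d \<in> E"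
        using Suc_dim Qp_diff by (auto simp: algebra_simps)
      then show ?thesis
        unfolding line by blast
    qed
    moreover have "k * x \<in> R.line_extension (Qp absv) v E"
      if kx: "k \<in> Qp absv" "x \<in> R.line_extension (Qp absv) v E" for k x
    proof -
      obtain a b where "x = a * v + b" "a \<in> Qp absv" "b \<in> E"
        using kx unfolding line by blast
      then have "k * x = (k * a) * v + k * b" "k * a \<in> Qp absv" "k * b \<in> E"
        using Suc_dim kx(1) Qp_mult by (auto simp: algebra_simps)
      then show ?thesis
        unfolding line by blast
    qed
    ultimately show ?case
      by blast
  qed
  then show ?thesis
    by blast
qed

lemma algebraic_over_Qp':
  "(ring.algebraic (ring_of_type_algebra :: 'a ring) over Qp absv) x"
proof -
  interpret R: field "ring_of_type_algebra :: 'a ring"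
    by (rule field_from_type_algebra)
  obtain P :: "'a poly" where P: "P \<noteq> 0" "\<And>i. Polynomial.coeff P i \<in> Qp absv" "poly P x = 0"
    using algebraic_over_Qp by blast
  show ?thesis
  proof (rule R.algebraicI)
    show "rev (coeffs P) \<in> carrier (univ_poly (ring_of_type_algebra :: 'a ring) (Qp absv))"
      using P(1,2)
      by (auto simp: univ_poly_def polynomial_def hd_rev last_coeffs_eq_coeff_degree coeffs_def
          ring_of_type_algebra_def)
    show "rev (coeffs P) \<noteq> []"
      using P(1) by simp
    show "R.eval (rev (coeffs P)) x = \<zero>\<^bsub>(ring_of_type_algebra :: 'a ring)\<^esub>"
      using P(3) by (simp flip: Poly_rev_eq_eval) (simp add: ring_of_type_algebra_def)
  qed
qed

text \<open>The algebraic closure is not complete, so limits are sought in the extension of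
  \<open>Qp absv\<close> generated by finitely many elements, which is finite since they are
  algebraic.\<close>

lemma exists_complete_subring:
  obtains M where "rat_subalgebra M" "set xs \<subseteq> M" "seq_complete absv M"
proof -
  let ?R = "ring_of_type_algebra :: 'a ring"
  interpret R: field ?R
    by (rule field_from_type_algebra)
  define M where "M = R.finite_extension (Qp absv) xs"
  have xs: "set xs \<subseteq> carrier ?R"
    by (simp add: ring_of_type_algebra_def)
  have Qp: "subring (Qp absv) ?R"
    using subfield_Qp by (rule subfieldE)
  have M: "subring M ?R"
    unfolding M_def using Qp xs by (rule R.finite_extension_is_subring)
  have "Qp absv \<subseteq> M"
    unfolding M_def using xs by (intro R.finite_extension_incl) (auto simp: ring_of_type_algebra_def)
  then have "\<rat> \<subseteq> M"
    using Qp_of_rat by (auto simp: Rats_def)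
  with M have "rat_subalgebra M"
    using subringE(6,7)[OF M] by unfold_locales (auto simp: ring_of_type_algebra_def)
  moreover have "set xs \<subseteq> M"
    unfolding M_def using Qp xs by (rule R.finite_extension_mem)
  moreover have "R.finite_dimension (Qp absv) M"
    unfolding M_def using subfield_Qp xs algebraic_over_Qp' by (rule R.finite_extension_finite_dimension)
  then have "seq_complete absv M"
    using seq_complete_finite_dimension unfolding R.finite_dimension_def by blast
  ultimately show thesis
    by (rule that)
qed

text \<open>The terms decay geometrically for \<open>|x| < 1 / r\<close>, hence the witness
  \<open>1 / r - 1\<close>. The list \<open>cs\<close> generates the coefficients, so adjoining
  \<open>cs\<close> and \<open>x\<close> gives one complete ring containing every partial
  sum.\<close>

lemma overconvergentI:
  assumes F: "fps_bounded M r F" "0 < r" "r < 1"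
    and coeffs: "\<And>S. rat_subalgebra S \<Longrightarrow> set cs \<subseteq> S \<Longrightarrow> F \<in> fps_coeffs_in S"
  shows "overconvergent absv F"
  unfolding overconvergent_def
proof (intro exI[of _ "1 / r - 1"] conjI allI impI)
  show "1 / r - 1 > 0"
    using F by simp
next
  fix x
  assume "absv x < 1 + (1 / r - 1)"
  then have rx: "r * absv x < 1"
    using F by (simp add: field_simps)
  obtain S where S: "rat_subalgebra S" "set (x # cs) \<subseteq> S" "seq_complete absv S"
    by (rule exists_complete_subring)
  interpret rat_subalgebra S
    by fact
  have "(\<lambda>n. M * (r * absv x) ^ n) \<longlonglongrightarrow> M * 0"
    using rx F(2) by (intro tendsto_mult_left LIMSEQ_realpow_zero) auto
  then have lim: "(\<lambda>n. M * (r * absv x) ^ n) \<longlonglongrightarrow> 0"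
    by simp
  have bound: "absv (fps_nth F n * x ^ n) \<le> M * (r * absv x) ^ n" for n
    using absv_mult_le[OF fps_boundedD[OF F(1)], of "x ^ n" "absv x ^ n" n]
    by (simp add: absv_power power_mult_distrib mult.assoc)
  have "(\<lambda>n. absv (fps_nth F n * x ^ n)) \<longlonglongrightarrow> 0"
    by (rule Lim_null_comparison[OF always_eventually lim]) (use bound in simp)
  then have "cauchy_seq absv (\<lambda>N. \<Sum>n<N. fps_nth F n * x ^ n)"
    by (rule cauchy_seq_partial_sums)
  moreover have "(\<Sum>n<N. fps_nth F n * x ^ n) \<in> S" for N
    using S coeffs[of S] by (auto simp: fps_coeffs_in_def intro!: sum_closed mult_closed power_closed)
  ultimately show "\<exists>l. converges_to absv (\<lambda>N. \<Sum>n<N. fps_nth F n * x ^ n) l"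
    using S(3) seq_completeE by metis
qed

end

section \<open>Factorization of the power series\<close>

text \<open>
  In powers of \<open>\<theta> = |\<gamma>|\<close>, this is the bound \<open>|\<omega>^(p^k) / p^k| \<le> \<theta> r^(p^k)\<close> for \<open>k = j + 3\<close>, where
  \<open>r^(p^3) = \<theta>\<close>.
\<close>

lemma exponent_bound:
  fixes p :: nat
  assumes "p \<ge> 3"
  shows "1 + p ^ j + (p - 1) * (j + 3) \<le> p ^ (j + 2)"
proof (induction j)
  case 0
  \<comment> \<open>This turns the inequality into a coefficientwise comparison of polynomials in
    \<open>q\<close>.\<close>
  obtain q where "p = q + 3"
    using assms nat_le_iff_add[of 3 p] by (auto simp: add.commute)
  then show ?case
    by (simp add: power2_eq_square algebra_simps)
next
  case (Suc j)
  obtain q where q: "p = q + 3"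
    using assms nat_le_iff_add[of 3 p] by (auto simp: add.commute)
  have "1 + p ^ Suc j + (p - 1) * (Suc j + 3) \<le> p * (1 + p ^ j + (p - 1) * (j + 3))"
    unfolding q by (simp add: algebra_simps)
  also have "\<dots> \<le> p * p ^ (j + 2)"
    using Suc by (intro mult_left_mono) auto
  finally show ?case
    by simp
qed

section \<open>The sizes of \<gamma> and \<omega>\<close>

locale dwork_parameters = padic_absv +
  fixes \<gamma> \<omega> u :: 'a
  assumes p_ge_3: "p \<ge> 3"
    and gamma_power: "\<gamma> ^ (p - 1) = - of_nat p"
    and omega: "\<omega> ^ p + u * of_nat p * \<omega> = \<gamma>"
    and absv_u: "absv u \<le> 1"
begin

lemma absv_gamma_power: "absv \<gamma> ^ (p - 1) = 1 / p"
  using arg_cong[OF gamma_power, of absv] by (simp add: absv_power absv_p)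

lemma absv_gamma_bounds: "1 / p \<le> absv \<gamma>" "absv \<gamma> < 1"
proof -
  have lt1: "absv \<gamma> ^ (p - 1) < 1"
    using absv_gamma_power p_gt_1 by simp
  then show "absv \<gamma> < 1"
    using one_le_power[of "absv \<gamma>" "p - 1"] by linarith
  then show "1 / p \<le> absv \<gamma>"
    using power_decreasing[of 1 "p - 1" "absv \<gamma>"] p_gt_1 absv_gamma_power by simp
qed

lemma absv_gamma_pos: "0 < absv \<gamma>"
  using absv_gamma_bounds p_gt_1 by (elim less_le_trans[rotated]) simp

lemma absv_u_p_omega: "absv (u * of_nat p * \<omega>) \<le> absv \<omega> / p"
  using absv_mult_le[OF absv_mult_le[OF absv_u, of "of_nat p" "1 / p"] order_refl, of \<omega>] absv_p
  by simp

text \<open>The term \<open>\<omega> ^ p\<close> dominates in the equation for \<omega>. Otherwise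
  \<open>|\<gamma>| \<le> |\<omega>| / p\<close> would force \<open>|\<omega>| \<ge> 1\<close>, and
  then \<open>|\<omega>| / p < |\<omega>| \<le> |\<omega> ^ p|\<close>, a contradiction.\<close>

lemma absv_omega_power: "absv \<omega> ^ p = absv \<gamma>"
proof (cases "absv (u * of_nat p * \<omega>) < absv (\<omega> ^ p)")
  case True
  then show ?thesis
    using absv_add_eq omega absv_power by metis
next
  case False
  then have *: "absv (\<omega> ^ p) \<le> absv \<omega> / p"
    using absv_u_p_omega by linarith
  then have "absv \<gamma> \<le> absv \<omega> / p"
    using absv_add_le absv_u_p_omega omega by metis
  then have "1 / p \<le> absv \<omega> / p"
    using absv_gamma_bounds by linarith
  then have "1 \<le> absv \<omega>"
    using p_gt_1 by (simp add: divide_le_cancel)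
  then have "absv \<omega> * 1 < absv \<omega> * p"
    using p_gt_1 by (intro mult_strict_left_mono) auto
  then have "absv \<omega> / p < absv \<omega>"
    using p_gt_1 by (simp add: pos_divide_less_eq)
  moreover have "absv \<omega> \<le> absv (\<omega> ^ p)"
    using \<open>1 \<le> absv \<omega>\<close> p_gt_1 self_le_power[of "absv \<omega>" p] by (simp add: absv_power)
  ultimately show ?thesis
    using * by simp
qed

lemma absv_omega_bounds: "1 / p \<le> absv \<omega>" "absv \<omega> < 1"
proof -
  show "absv \<omega> < 1"
    using one_le_power[of "absv \<omega>" p] absv_omega_power absv_gamma_bounds by linarith
  then show "1 / p \<le> absv \<omega>"
    using power_decreasing[of 1 p "absv \<omega>"] p_gt_1 absv_omega_power absv_gamma_bounds by simp
qed

text \<open>With \<open>b = u * p * \<omega>\<close>, each middle term of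
  \<open>(\<omega> ^ p + b) ^ p\<close> has one factor \<open>p\<close> from the binomial
  coefficient and one from \<open>b\<close>. They match the denominator \<open>p^2\<close> at
  \<open>X^(p^2)\<close> in the exponent.\<close>

lemma absv_gamma_power_diff: "absv (\<gamma> ^ p - \<omega> ^ p\<^sup>2) \<le> absv \<gamma> * absv \<omega> / p\<^sup>2"
proof -
  let ?b = "u * of_nat p * \<omega>"
  have le: "absv \<omega> / p \<le> absv \<gamma>"
    using absv_gamma_bounds absv_omega_bounds p_gt_1 by (intro order_trans[OF _ absv_gamma_bounds(1)] divide_right_mono) auto
  have summands: "absv (of_nat (p choose k) * (\<omega> ^ p) ^ k * ?b ^ (p - k)) \<le> absv \<gamma> * absv \<omega> / p\<^sup>2"
    if k: "k \<in> {0<..<p}" for k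
  proof -
    have p_k: "p - k = Suc (p - k - 1)"
      using k by auto
    have "absv (of_nat (p choose k) * (\<omega> ^ p) ^ k * ?b ^ (p - k)) \<le>
        1 / p * absv \<gamma> ^ k * (absv \<omega> / p) ^ (p - k)"
      using k absv_u_p_omega
      by (intro absv_mult_le absv_choose_le) (auto simp: absv_power absv_omega_power intro!: power_mono)
    \<comment> \<open>One factor is kept as \<open>|\<omega>| / p\<close>; the other
      \<open>p - k - 1\<close> are weakened to \<open>|\<gamma>|\<close>, giving in total
      \<open>|\<gamma>| ^ (p - 1) = 1 / p \<le> |\<gamma>|\<close>.\<close>
    also have "(absv \<omega> / p) ^ (p - k) = absv \<omega> / p * (absv \<omega> / p) ^ (p - k - 1)"
      by (subst p_k) simp
    also have "1 / p * absv \<gamma> ^ k * \<dots> \<le> 1 / p * absv \<gamma> ^ k * (absv \<omega> / p * absv \<gamma> ^ (p - k - 1))"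
      using le by (intro mult_left_mono power_mono) auto
    also have "\<dots> = absv \<omega> / p\<^sup>2 * absv \<gamma> ^ (k + (p - k - 1))"
      by (simp add: power_add power2_eq_square)
    also have "k + (p - k - 1) = p - 1"
      using k by auto
    also have "absv \<omega> / p\<^sup>2 * absv \<gamma> ^ (p - 1) \<le> absv \<omega> / p\<^sup>2 * absv \<gamma>"
      unfolding absv_gamma_power using absv_gamma_bounds by (intro mult_left_mono) auto
    finally show ?thesis
      by (simp add: mult.commute)
  qed
  have b: "absv (?b ^ p) \<le> absv \<gamma> * absv \<omega> / p\<^sup>2"
  proof -
    have "absv (?b ^ p) \<le> (absv \<omega> / p) ^ p"
      unfolding absv_power using absv_u_p_omega by (intro power_mono) auto
    also have "\<dots> = absv \<gamma> * (1 / p) ^ p"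
      by (simp add: power_divide absv_omega_power)
    \<comment> \<open>Of three factors \<open>1 / p\<close>, two supply the denominator
      \<open>p^2\<close> and one is at most \<open>|\<omega>|\<close>.\<close>
    also have "\<dots> \<le> absv \<gamma> * (1 / p) ^ 3"
      using p_ge_3 by (intro mult_left_mono power_decreasing) auto
    also have "\<dots> = absv \<gamma> * (1 / p / p\<^sup>2)"
      by (simp add: power2_eq_square power3_eq_cube)
    also have "\<dots> \<le> absv \<gamma> * (absv \<omega> / p\<^sup>2)"
      using absv_omega_bounds by (intro mult_left_mono divide_right_mono) auto
    finally show ?thesis
      by simp
  qed
  have "\<gamma> ^ p - \<omega> ^ p\<^sup>2 = (\<gamma> ^ p - (\<omega> ^ p) ^ p - ?b ^ p) + ?b ^ p"
    by (simp add: power2_eq_square power_mult)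
  also have "\<gamma> ^ p - (\<omega> ^ p) ^ p - ?b ^ p = (\<omega> ^ p + ?b) ^ p - (\<omega> ^ p) ^ p - ?b ^ p"
    by (simp only: omega)
  also have "\<dots> = (\<Sum>k\<in>{0<..<p}. of_nat (p choose k) * (\<omega> ^ p) ^ k * ?b ^ (p - k))"
    using p_gt_1 by (intro add_power_prime_diff) auto
  finally show ?thesis
    using summands b by (auto intro!: absv_add_le absv_sum_le)
qed

section \<open>The exponent compared with the Artin-Hasse logarithm\<close>

definition E2_log :: "'a fps" where
  "E2_log = fps_const \<omega> * fps_X - fps_const (u * \<omega>) * fps_X ^ p +
      fps_const (1 / of_nat p) * (fps_const \<gamma> * fps_X ^ p - fps_const \<gamma> * fps_X ^ (p ^ 2))"

definition E2_log_remainder :: "'a fps" where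
  "E2_log_remainder = E2_log - (artin_hasse_log p oo (fps_const \<omega> * fps_X))"

text \<open>For this radius \<open>rad ^ (p^2) = |\<omega>|\<close>, so the bound
  \<open>|\<gamma>| * |\<omega>|\<close> for the coefficient of \<open>X^(p^2)\<close> is exactly
  \<open>|\<gamma>| * rad ^ n\<close>.\<close>

definition rad :: real where
  "rad = root (p ^ 3) (absv \<gamma>)"

lemma rad_bounds: "0 < rad" "rad < 1"
  using absv_gamma_pos absv_gamma_bounds p_gt_1 by (auto simp: rad_def)

lemma rad_power: "rad ^ p ^ (j + 3) = absv \<gamma> ^ p ^ j"
proof -
  have "rad ^ p ^ 3 = absv \<gamma>"
    unfolding rad_def using p_gt_1 absv_gamma_pos by (intro real_root_pow_pos2) auto
  then show ?thesis
    by (simp add: power_add mult.commute[of "p ^ j"] power_mult)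
qed

lemma rad_power_p2: "rad ^ p\<^sup>2 = absv \<omega>"
proof (rule power_eq_imp_eq_base)
  have "(rad ^ p\<^sup>2) ^ p = rad ^ p ^ (0 + 3)"
    by (simp add: power2_eq_square power3_eq_cube flip: power_mult)
  then show "(rad ^ p\<^sup>2) ^ p = absv \<omega> ^ p"
    by (simp only: rad_power absv_omega_power) simp
qed (use rad_bounds p_gt_1 in auto)

lemma E2_log_nth:
  "fps_nth E2_log n = (if n = 1 then \<omega> else 0) - (if n = p then u * \<omega> else 0) +
    1 / of_nat p * ((if n = p then \<gamma> else 0) - (if n = p\<^sup>2 then \<gamma> else 0))"
  by (simp add: E2_log_def)

text \<open>Only indices \<open>p ^ k\<close> contribute. The coefficients for \<open>k = 0\<close>
  and \<open>k = 1\<close> cancel, the latter by the equation for \<omega>; \<open>k = 2\<close>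
  leaves \<open>(\<gamma> ^ p - \<omega> ^ (p^2)) / p^2\<close>, and \<open>k \<ge> 3\<close> only
  the Artin-Hasse tail.\<close>

lemma fps_bounded_E2_log_remainder: "fps_bounded (absv \<gamma>) rad E2_log_remainder"
  unfolding fps_bounded_def
proof
  fix n
  have nth: "fps_nth E2_log_remainder n =
      fps_nth E2_log n - \<omega> ^ n * (if \<exists>k. n = p ^ k then 1 / of_nat n else 0)"
    by (simp add: E2_log_remainder_def artin_hasse_log_def)
  have p_neq: "p \<noteq> 1" "Suc 0 \<noteq> p\<^sup>2" "p\<^sup>2 \<noteq> 1" "p\<^sup>2 \<noteq> p" "p > 0"
    using p_gt_1 by (auto simp: power2_eq_square)
  show "absv (fps_nth E2_log_remainder n) \<le> absv \<gamma> * rad ^ n"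
  proof (cases "\<exists>k. n = p ^ k")
    case False
    then have "n \<noteq> 1" "n \<noteq> p" "n \<noteq> p\<^sup>2"
      by (metis power_0, metis power_one_right, metis)
    then have "fps_nth E2_log_remainder n = 0"
      unfolding nth E2_log_nth using False by simp
    then show ?thesis
      using rad_bounds by simp
  next
    case True
    then obtain k where k: "n = p ^ k"
      by blast
    then have nth: "fps_nth E2_log_remainder n = fps_nth E2_log n - \<omega> ^ p ^ k / of_nat p ^ k"
      unfolding nth by auto
    consider "k = 0" | "k = 1" | "k = 2" | j where "k = j + 3"
      by (metis One_nat_def Suc_1 add.commute add_Suc_right less_2_cases nat_le_iff_add not_less numeral_3_eq_3 not_less_eq_eq le_antisym)
    then show ?thesis
    proof cases
      case 1
      then have "fps_nth E2_log_remainder n = 0"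
        using p_gt_1 unfolding nth E2_log_nth unfolding k by (auto simp: p_neq)
      then show ?thesis
        using rad_bounds by simp
    next
      case 2
      then have "fps_nth E2_log_remainder n = (\<gamma> - u * of_nat p * \<omega> - \<omega> ^ p) / of_nat p"
        using p_neq unfolding nth E2_log_nth unfolding k by (simp add: field_simps)
      then show ?thesis
        using rad_bounds by (simp flip: omega)
    next
      case 3
      have "\<gamma> ^ p = \<gamma> * \<gamma> ^ (p - 1)"
        using p_gt_1 by (simp flip: power_Suc)
      then have "\<gamma> ^ p = - of_nat p * \<gamma>"
        unfolding gamma_power by (simp add: mult.commute)
      then have "fps_nth E2_log_remainder n = (\<gamma> ^ p - \<omega> ^ p\<^sup>2) / of_nat p ^ 2"
        using p_neq 3 unfolding nth E2_log_nth unfolding k by (simp add: field_simps power2_eq_square)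
      also have "absv \<dots> = absv (\<gamma> ^ p - \<omega> ^ p\<^sup>2) * p\<^sup>2"
        by (simp add: absv_divide absv_power absv_p power_divide)
      also have "\<dots> \<le> absv \<gamma> * absv \<omega> / p\<^sup>2 * p\<^sup>2"
        by (intro mult_right_mono absv_gamma_power_diff) auto
      also have "\<dots> = absv \<gamma> * absv \<omega>"
        using p_gt_1 by simp
      finally show ?thesis
        by (simp add: k 3 rad_power_p2)
    next
      case 4
      have "p ^ k \<noteq> 1" "p ^ k \<noteq> p" "p ^ k \<noteq> p\<^sup>2"
        using p_gt_1 4 power_inject_exp[of p k 0] power_inject_exp[of p k 1] power_inject_exp[of p k 2]
        by auto
      then have "fps_nth E2_log_remainder n = - (\<omega> ^ p ^ k / of_nat p ^ k)"
        unfolding nth E2_log_nth unfolding k by simp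
      then have "absv (fps_nth E2_log_remainder n) = absv \<omega> ^ p ^ k * real p ^ k"
        by (simp add: absv_divide absv_power absv_p power_divide)
      \<comment> \<open>One factor \<open>p\<close> of the exponent turns \<open>|\<omega>|\<close>
        into \<open>|\<gamma>|\<close>.\<close>
      also have "p ^ k = p * p ^ (j + 2)"
        by (simp add: 4 eval_nat_numeral)
      also have "absv \<omega> ^ (p * p ^ (j + 2)) = absv \<gamma> ^ p ^ (j + 2)"
        by (simp only: power_mult absv_omega_power)
      \<comment> \<open>In the new exponent, \<open>1\<close> gives the constant
        \<open>|\<gamma>|\<close>, \<open>p ^ j\<close> gives \<open>rad ^ n\<close>, and
        \<open>(p - 1) * k\<close> gives \<open>(1 / p) ^ k\<close>, which cancels
        \<open>p ^ k\<close>.\<close>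
      also have "absv \<gamma> ^ p ^ (j + 2) * real p ^ k \<le> absv \<gamma> ^ (1 + p ^ j + (p - 1) * k) * real p ^ k"
        using absv_gamma_bounds exponent_bound[OF p_ge_3, of j] unfolding 4
        by (intro mult_right_mono power_decreasing) auto
      also have "absv \<gamma> ^ (1 + p ^ j + (p - 1) * k) = absv \<gamma> * absv \<gamma> ^ p ^ j * (1 / p) ^ k"
        by (simp only: power_add power_mult absv_gamma_power power_one_right)
      also have "\<dots> * real p ^ k = absv \<gamma> * rad ^ n"
        using p_gt_1 unfolding k 4 rad_power by (simp add: power_divide)
      finally show ?thesis .
    qed
  qed
qed

lemma E2_factorization:
  "E2 p \<gamma> u \<omega> = (artin_hasse p oo (fps_const \<omega> * fps_X)) * (fps_exp 1 oo E2_log_remainder)"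
proof -
  have "(artin_hasse_log p oo (fps_const \<omega> * fps_X)) + E2_log_remainder = E2_log"
    by (simp add: E2_log_remainder_def)
  then have "E2 p \<gamma> u \<omega> = fps_exp 1 oo ((artin_hasse_log p oo (fps_const \<omega> * fps_X)) + E2_log_remainder)"
    by (simp only: E2_def E2_log_def)
  also have "\<dots> = (fps_exp 1 oo (artin_hasse_log p oo (fps_const \<omega> * fps_X))) *
      (fps_exp 1 oo E2_log_remainder)"
    using p_gt_1 by (intro fps_exp_compose_add) (auto simp: E2_log_remainder_def E2_log_def)
  also have "fps_exp 1 oo (artin_hasse_log p oo (fps_const \<omega> * fps_X)) =
      artin_hasse p oo (fps_const \<omega> * fps_X)"
    using p_gt_1 by (simp add: artin_hasse_def fps_compose_assoc)
  finally show ?thesis .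
qed

text \<open>By integrality the first factor has coefficients of size at most
  \<open>|\<omega>| ^ n\<close>, and \<open>|\<omega>| = rad ^ (p^2) \<le> rad\<close>. The second
  is the exponential bound with \<open>\<theta> = |\<gamma>|\<close>.\<close>

lemma fps_bounded_E2: "fps_bounded 1 rad (E2 p \<gamma> u \<omega>)"
proof -
  have "absv \<omega> \<le> rad"
    unfolding rad_power_p2[symmetric] using rad_bounds p_gt_1 power_decreasing[of 1 "p\<^sup>2" rad] by simp
  moreover have "fps_bounded 1 (absv \<omega>) (artin_hasse p oo (fps_const \<omega> * fps_X))"
    using artin_hasse_integral by (auto simp: fps_bounded_def absv_mult absv_power intro: mult_left_le)
  ultimately have "fps_bounded 1 rad (artin_hasse p oo (fps_const \<omega> * fps_X))"
    by (elim fps_bounded_mono) auto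
  moreover have "fps_bounded 1 rad (fps_exp 1 oo E2_log_remainder)"
    using absv_gamma_pos absv_gamma_power fps_bounded_E2_log_remainder rad_bounds
    by (intro fps_bounded_exp_compose) auto
  ultimately show ?thesis
    using fps_bounded_mult rad_bounds unfolding E2_factorization by fastforce
qed

end

section \<open>From the hypotheses of the theorem to the criterion\<close>

lemma (in rat_subalgebra) E2_closed:
  assumes "\<gamma> \<in> S" "u \<in> S" "\<omega> \<in> S"
  shows "E2 p \<gamma> u \<omega> \<in> fps_coeffs_in S"
proof -
  have "1 / of_nat p \<in> (\<rat> :: 'a set)"
    by (intro Rats_divide Rats_1 Rats_of_nat)
  then have rat: "0 \<in> S" "1 / of_nat p \<in> S" "- 1 \<in> S"
    using Rats_subset by auto
  have minus: "- x \<in> S" and divide: "x / of_nat p \<in> S" if "x \<in> S" for x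
    using mult_closed[OF rat(3) that] mult_closed[OF that rat(2)] by simp_all
  have diff: "x - y \<in> S" if "x \<in> S" "y \<in> S" for x y
    using add_closed[OF that(1) minus[OF that(2)]] by simp
  show ?thesis
    unfolding E2_def using assms rat
    by (intro fps_exp_compose_closed)
       (auto simp: fps_coeffs_in_def intro!: add_closed mult_closed minus divide diff)
qed

text \<open>Ensures \<open>q - 1 > 0\<close>, so that \<open>u ^ (q - 1) = 1\<close> makes
  \<open>u\<close> a root of unity. Degree 0 would give \<open>K = {0}\<close>, although
  \<open>1\<close> lies in \<open>Qp absv\<close>.\<close>

lemma (in padic_algebraic_closure) unramified_extension_degree_pos:
  assumes "unramified_extension absv d K"
  shows "d > 0"
proof (rule Nat.gr0I)
  interpret R: field "ring_of_type_algebra :: 'a ring"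
    by (rule field_from_type_algebra)
  assume "d = 0"
  then have "R.dimension 0 (Qp absv) K"
    using assms by (simp add: unramified_extension_def)
  then have "K = {0}"
    using R.dimension_zero[OF subfield_Qp] by (simp add: ring_of_type_algebra_def)
  then show False
    using assms Qp_of_rat[of 1] by (auto simp: unramified_extension_def)
qed

theorem theorem2p2:
  fixes p d q :: nat
    and absv :: "'a :: {alg_closed_field, field_char_0} \<Rightarrow> real"
    and K :: "'a set"
    and \<gamma> u \<omega> :: 'a
  assumes "Factorial_Ring.prime p" and "odd p"
    and "padic_algebraic_closure p absv"
    and "unramified_extension absv d K"
    and "q = p ^ d"
    and "poly (Polynomial.monom 1 (p - 1) + [:of_nat p:]) \<gamma> = 0"
    and "u ^ (q - 1) = 1"
    and "poly (f_poly p u - [:\<gamma>:]) \<omega> = 0"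
  shows "overconvergent absv (E2 p \<gamma> u \<omega>)"
proof -
  interpret padic_algebraic_closure p absv
    by fact
  have p: "p \<ge> 3"
    using assms(1,2) prime_ge_2_nat[of p] by (cases "p = 2") auto
  have "p ^ d > 1"
    using p unramified_extension_degree_pos[OF assms(4)] by (intro one_less_power) auto
  then have "absv u = 1"
    using absv_root_of_unity[OF assms(7)] assms(5) by simp
  moreover have "\<gamma> ^ (p - 1) = - of_nat p"
    using assms(6) by (simp add: poly_monom add_eq_0_iff2)
  moreover have "\<omega> ^ p + u * of_nat p * \<omega> = \<gamma>"
    using assms(8) by (simp add: f_poly_def poly_monom)
  ultimately interpret dwork_parameters absv p \<gamma> \<omega> u
    using assms(1) p absv_p by unfold_locales auto
  show ?thesis
    using fps_bounded_E2 rad_bounds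
    by (rule overconvergentI[where cs = "[\<gamma>, u, \<omega>]"]) (auto intro: rat_subalgebra.E2_closed)
qed

end
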